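(* For every positive integer $n$ the following holds. If $n$ is even, then $P(n,n)=\frac{3}{2}n$. If $n$ is odd, then \[\left\lfloor \tfrac{3}{2}n\right\rfloor-1\le P(n,n)\le \left\lfloor \tfrac{3}{2}n\right\rfloor .\]
   Context: A permutation of $[n]=\{1,2,\ldots,n\}$ is regarded as a linear ordering (sequence) of the elements of $[n]$. Two permutations of $[n]$ are $k$-neighbor separated if there are two elements of $[n]$ that are neighbors (occupy consecutive positions) in one of the permutations and are separated by exactly $k-2$ other elements in the other permutation. $P(n,k)$ denotes the maximal number of pairwise $k$-neighbor separated permutations of $[n]$ (the maximum size of a family in which any two distinct members are $k$-neighbor separated); here $k=n$.
   Formalization: The even case is stated for even n other than 2, since [2] has only two permutations, so P(2,2) = 2 and not 3. *)

theory Defs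
  imports Complex_Main "HOL-Combinatorics.Multiset_Permutations"
begin

text \<open>
  A permutation of \<open>[n]\<close> is a sequence: an element of \<open>permutations_of_set {1..n}\<close>, that is,
  a distinct list whose set of entries is \<open>{1..n}\<close>. In particular a permutation and its reversal
  are different sequences (for \<open>n \<ge> 2\<close>).
\<close>

definition neighbors_in :: "'a list \<Rightarrow> 'a \<Rightarrow> 'a \<Rightarrow> bool" where
  "neighbors_in xs a b \<longleftrightarrow> (\<exists>i. Suc i < length xs \<and> {xs ! i, xs ! Suc i} = {a, b})"

text \<open>
  The number of separating elements is an integer, so that \<open>k - 2\<close> is not truncated:
  for \<open>k < 2\<close> no two elements are separated by exactly \<open>k - 2\<close> others.
\<close>

definition separated_by_in :: "int \<Rightarrow> 'a list \<Rightarrow> 'a \<Rightarrow> 'a \<Rightarrow> bool" where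
  "separated_by_in m xs a b \<longleftrightarrow>
     (\<exists>i j. i < j \<and> j < length xs \<and> {xs ! i, xs ! j} = {a, b} \<and> int (card {i<..<j}) = m)"

definition neighbor_separated :: "nat \<Rightarrow> 'a list \<Rightarrow> 'a list \<Rightarrow> bool" where
  "neighbor_separated k xs ys \<longleftrightarrow>
     (\<exists>a b. (neighbors_in xs a b \<and> separated_by_in (int k - 2) ys a b) \<or>
            (neighbors_in ys a b \<and> separated_by_in (int k - 2) xs a b))"

definition neighbor_separated_families :: "nat \<Rightarrow> nat \<Rightarrow> nat list set set" where
  "neighbor_separated_families n k =
     {F. F \<subseteq> permutations_of_set {1..n} \<and> pairwise (neighbor_separated k) F}"

definition P :: "nat \<Rightarrow> nat \<Rightarrow> nat" where
  "P n k = Max (card ` neighbor_separated_families n k)"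

text \<open>The maximum is taken over a finite nonempty set, hence it is attained.\<close>

lemma finite_neighbor_separated_families: "finite (neighbor_separated_families n k)"
  unfolding neighbor_separated_families_def
  by (rule finite_subset[of _ "Pow (permutations_of_set {1..n})"]) auto

lemma empty_in_neighbor_separated_families: "{} \<in> neighbor_separated_families n k"
  by (simp add: neighbor_separated_families_def)

text \<open>
  There are only two permutations of \<open>[2]\<close>, so \<open>P 2 2\<close> is \<open>2\<close> and not \<open>3/2 * 2\<close>.
\<close>

lemma P_2_2: "P 2 2 = 2"
proof -
  have perms: "permutations_of_set {1..2::nat} = {[1,2],[2,1]}" (is "?S = ?T")
  proof (rule card_subset_eq[symmetric])
    show "?T \<subseteq> ?S" by (auto simp: permutations_of_set_def)
    show "card ?T = card ?S" by simp
  qed simp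
  have nb: "neighbors_in [1,2::nat] 1 2"
    unfolding neighbors_in_def by (rule exI[of _ 0]) simp
  have sep: "separated_by_in (int 2 - 2) [2,1::nat] 1 2"
    unfolding separated_by_in_def by (rule exI[of _ 0], rule exI[of _ 1]) auto
  have "neighbor_separated 2 [1,2::nat] [2,1]" "neighbor_separated 2 [2,1::nat] [1,2]"
    using nb sep unfolding neighbor_separated_def by blast+
  then have "{[1,2],[2,1]} \<in> neighbor_separated_families 2 2"
    by (auto simp: neighbor_separated_families_def perms pairwise_insert simp del: One_nat_def)
  then have "card {[1,2],[2,1::nat]} \<in> card ` neighbor_separated_families 2 2"
    by (rule imageI)
  then have mem: "2 \<in> card ` neighbor_separated_families 2 2"
    by (simp add: numeral_2_eq_2)
  have le: "card F \<le> 2" if "F \<in> neighbor_separated_families 2 2" for F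
    using that card_mono[of "{[1,2],[2,1::nat]}" F]
    by (auto simp: neighbor_separated_families_def perms simp del: One_nat_def)
  show ?thesis
    unfolding P_def
    by (rule Max_eqI) (use mem le finite_neighbor_separated_families in auto)
qed

end

theory Submission
  imports Defs
begin

text \<open>
  For \<open>k = n\<close> the two elements that are separated by \<open>k - 2\<close> others are the two ends of the sequence.
  So two permutations are separated iff the ends of one of them are neighbors in the other. Read a
  permutation as a Hamiltonian path of the complete graph on \<open>[n]\<close> and its ends as an edge; the
  condition says that the edge of one member lies on the path of the other.

  Upper bound, for \<open>n \<ge> 3\<close>. Fix a vertex \<open>v\<close> and look at the members that end at \<open>v\<close>. Each of their paths
  leaves \<open>v\<close> by a single edge, so it contains the edge of at most one other such member. A relation
  that connects every pair and has out-degree at most one lives on at most three points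
  (\<open>card_le_3_if_out_degree_le_1\<close>), so at most three members end at \<open>v\<close>
  (\<open>card_family_with_end_le_3\<close>). Every member has two ends, whence \<open>2 |F| \<le> 3 n\<close>.

  Lower bound. Equality forces the edges of the members to form a cubic graph, and this
  graph may be disconnected. Suppose that cubic graphs on \<open>V\<close> and on \<open>W\<close> are
  each served by a family of paths, that every path can be cut at one place without losing the
  separation inside its own family, and that the edges of each graph are split into two classes, each
  lying along one path. A path of the first family then receives, at its cut, a
  path of \<open>W\<close> that contains a whole class of edges of the second graph, and vice versa. Two classes
  on each side suffice to arrange that for every edge \<open>e\<close> on \<open>V\<close> and \<open>f\<close> on \<open>W\<close> one of the two
  paths contains the other edge (\<open>splice_family_merge\<close>), and the cuts survive the operation. Starting from
  explicit families on 6, 8 and 10 vertices this reaches every even \<open>n \<ge> 6\<close>; the values 3, 4 and 5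
  have families of their own. For odd \<open>n \<ge> 7\<close> the
  element \<open>n\<close> is put into the cuts of a family on \<open>[n - 1]\<close>; this is where the loss of one occurs.
\<close>

section \<open>Neighbors and endpoints\<close>

lemma neighbors_in_iff_append:
  "neighbors_in xs a b \<longleftrightarrow> (\<exists>ys zs. xs = ys @ a # b # zs \<or> xs = ys @ b # a # zs)"
proof
  assume "neighbors_in xs a b"
  then obtain i where i: "Suc i < length xs" "{xs ! i, xs ! Suc i} = {a, b}"
    by (auto simp: neighbors_in_def)
  then have "xs = take i xs @ xs ! i # xs ! Suc i # drop (Suc (Suc i)) xs"
    by (metis Cons_nth_drop_Suc Suc_lessD id_take_nth_drop)
  with i(2) show "\<exists>ys zs. xs = ys @ a # b # zs \<or> xs = ys @ b # a # zs"
    by (metis doubleton_eq_iff)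
next
  assume "\<exists>ys zs. xs = ys @ a # b # zs \<or> xs = ys @ b # a # zs"
  then obtain ys zs where "xs = ys @ a # b # zs \<or> xs = ys @ b # a # zs"
    by blast
  then show "neighbors_in xs a b"
    unfolding neighbors_in_def by (intro exI[of _ "length ys"]) (auto simp: nth_append)
qed

lemma ex_nat_split: "(\<exists>i. Q i) \<longleftrightarrow> Q 0 \<or> (\<exists>i. Q (Suc i))"
  by (metis not0_implies_Suc)

lemma neighbors_in_simps [simp]:
  "\<not> neighbors_in [] a b"
  "\<not> neighbors_in [x] a b"
  "neighbors_in (x # y # zs) a b \<longleftrightarrow> (x = a \<and> y = b) \<or> (x = b \<and> y = a) \<or> neighbors_in (y # zs) a b"
proof -
  show "\<not> neighbors_in [] a b" "\<not> neighbors_in [x] a b"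
    by (auto simp: neighbors_in_def)
  show "neighbors_in (x # y # zs) a b \<longleftrightarrow> (x = a \<and> y = b) \<or> (x = b \<and> y = a) \<or> neighbors_in (y # zs) a b"
    unfolding neighbors_in_def ex_nat_split[where Q = "\<lambda>i. Suc i < length (x # y # zs) \<and> _ i"]
    by (auto simp: doubleton_eq_iff)
qed

lemma neighbors_in_append:
  "neighbors_in xs a b \<Longrightarrow> neighbors_in (xs @ ys) a b"
  "neighbors_in ys a b \<Longrightarrow> neighbors_in (xs @ ys) a b"
proof -
  show "neighbors_in (xs @ ys) a b" if "neighbors_in xs a b"
    using that unfolding neighbors_in_def by (auto simp: nth_append intro: exI)
  show "neighbors_in (xs @ ys) a b" if "neighbors_in ys a b"
  proof -
    from that obtain i where "Suc i < length ys" "{ys ! i, ys ! Suc i} = {a, b}"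
      by (auto simp: neighbors_in_def)
    then show ?thesis
      unfolding neighbors_in_def by (intro exI[of _ "length xs + i"]) (simp add: nth_append)
  qed
qed

lemma neighbors_in_map: "neighbors_in xs a b \<Longrightarrow> neighbors_in (map f xs) (f a) (f b)"
  unfolding neighbors_in_def by (auto simp: doubleton_eq_iff)

lemma neighbors_in_sym: "neighbors_in xs a b \<longleftrightarrow> neighbors_in xs b a"
  unfolding neighbors_in_def by (simp add: insert_commute)

lemma neighbors_in_hd:
  assumes "distinct xs" "neighbors_in xs (hd xs) w"
  shows "w = xs ! 1"
proof -
  from assms(2) obtain i where i: "Suc i < length xs" "{xs ! i, xs ! Suc i} = {hd xs, w}"
    by (auto simp: neighbors_in_def)
  then have "hd xs = xs ! 0"
    by (cases xs) auto
  moreover have "0 < length xs" "i < length xs"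
    using i(1) by linarith+
  ultimately show ?thesis
    using i assms(1) by (auto simp: doubleton_eq_iff nth_eq_iff_index_eq)
qed

lemma neighbors_in_rev: "neighbors_in (rev xs) a b \<longleftrightarrow> neighbors_in xs a b"
proof -
  have "neighbors_in (rev xs) a b" if "neighbors_in xs a b" for xs :: "'a list"
    using that unfolding neighbors_in_iff_append
    by (elim exE disjE) (simp, blast)+
  from this[of xs] this[of "rev xs"] show ?thesis by auto
qed

lemma neighbors_in_last:
  assumes "distinct xs" "neighbors_in xs (last xs) w"
  shows "w = rev xs ! 1"
  using neighbors_in_hd[of "rev xs" w] assms by (simp add: neighbors_in_rev hd_rev)

lemma not_neighbors_in_ends:
  assumes "distinct xs" "length xs \<ge> 3"
  shows "\<not> neighbors_in xs (hd xs) (last xs)"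
proof
  assume "neighbors_in xs (hd xs) (last xs)"
  with assms(1) have "last xs = xs ! 1"
    by (rule neighbors_in_hd)
  moreover have "last xs = xs ! (length xs - 1)"
    using assms(2) by (intro last_conv_nth) auto
  ultimately show False
    using assms by (simp add: nth_eq_iff_index_eq)
qed

lemma separated_by_in_iff_ends:
  assumes "length xs = n" "n \<ge> 2"
  shows "separated_by_in (int n - 2) xs a b \<longleftrightarrow> {hd xs, last xs} = {a, b}"
proof -
  have "i < j \<and> j < length xs \<and> int (card {i<..<j}) = int n - 2 \<longleftrightarrow> i = 0 \<and> j = n - 1" for i j
    using assms by auto
  then have "separated_by_in (int n - 2) xs a b \<longleftrightarrow> {xs ! 0, xs ! (n - 1)} = {a, b}"
    unfolding separated_by_in_def by metis
  moreover have "xs \<noteq> []"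
    using assms by auto
  ultimately show ?thesis
    using assms(1) by (simp add: hd_conv_nth last_conv_nth)
qed

definition ends_adjacent_in :: "'a list \<Rightarrow> 'a list \<Rightarrow> bool" where
  "ends_adjacent_in xs ys \<longleftrightarrow> neighbors_in xs (hd ys) (last ys)"

lemma neighbor_separated_iff_ends:
  assumes "length xs = n" "length ys = n" "n \<ge> 2"
  shows "neighbor_separated n xs ys \<longleftrightarrow> ends_adjacent_in xs ys \<or> ends_adjacent_in ys xs"
  unfolding neighbor_separated_def ends_adjacent_in_def
    separated_by_in_iff_ends[OF assms(1,3)] separated_by_in_iff_ends[OF assms(2,3)]
  by (metis doubleton_eq_iff neighbors_in_sym)

lemma permutation_of_interval:
  assumes "xs \<in> permutations_of_set {1..n::nat}"
  shows "length xs = n" "distinct xs" "set xs = {1..n}"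
  using assms by (auto simp: permutations_of_set_def dest: distinct_card[symmetric])

section \<open>The upper bound\<close>

text \<open>
  On \<open>d\<close> points there are \<open>d (d - 1) / 2\<close> pairs to connect and at most \<open>d\<close> arcs to do it.
\<close>

lemma card_le_3_if_out_degree_le_1:
  assumes "finite D"
    and out: "\<And>x. x \<in> D \<Longrightarrow> card {y \<in> D. R x y} \<le> 1"
    and total: "pairwise (\<lambda>x y. R x y \<or> R y x) D"
  shows "card D \<le> 3"
proof -
  define A where "A = Sigma D (\<lambda>x. {y \<in> D. R x y})"
  define N where "N = Sigma D (\<lambda>x. D - {x})"
  have fin: "finite A"
    using \<open>finite D\<close> by (simp add: A_def)
  have "card A = (\<Sum>x\<in>D. card {y \<in> D. R x y})"
    unfolding A_def using \<open>finite D\<close> by simp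
  also have "\<dots> \<le> (\<Sum>x\<in>D. 1)"
    by (intro sum_mono out)
  finally have A: "card A \<le> card D" by simp
  have "N \<subseteq> A \<union> A\<inverse>"
    using total by (auto simp: N_def A_def pairwise_def)
  then have "card N \<le> card (A \<union> A\<inverse>)"
    using fin by (intro card_mono) auto
  also have "\<dots> \<le> card A + card (A\<inverse>)"
    by (rule card_Un_le)
  also have "card (A\<inverse>) = card A"
    by simp
  finally have "card N \<le> 2 * card D"
    using A by simp
  moreover have "card N = card D * (card D - 1)"
    unfolding N_def using \<open>finite D\<close> by simp
  ultimately have "card D * (card D - 1) \<le> card D * 2"
    by simp
  then show ?thesis
    by (auto simp: mult_le_cancel1)
qed

text \<open>
  If \<open>v\<close> is an end of \<open>xs\<close> and \<open>w\<close> is its only neighbor in \<open>xs\<close>, then a member that ends at \<open>v\<close> and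
  whose ends are neighbors in \<open>xs\<close> has the ends \<open>v\<close> and \<open>w\<close>. There is at most one such member: two
  members with the same pair of ends are not separated, because for \<open>n \<ge> 3\<close> the ends of a
  sequence are not neighbors in it.
\<close>

lemma card_family_with_end_le_3:
  assumes F: "F \<in> neighbor_separated_families n n" and "n \<ge> 3"
  shows "card {xs \<in> F. v = hd xs \<or> v = last xs} \<le> 3" (is "card ?D \<le> 3")
proof (rule card_le_3_if_out_degree_le_1[where R = ends_adjacent_in])
  have perm: "length xs = n" "distinct xs" "xs \<noteq> []" if "xs \<in> F" for xs
    using F that permutation_of_interval[of xs n] \<open>n \<ge> 3\<close>
    by (auto simp: neighbor_separated_families_def)
  have sep: "ends_adjacent_in xs ys \<or> ends_adjacent_in ys xs"
    if "xs \<in> F" "ys \<in> F" "xs \<noteq> ys" for xs ys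
    using F that neighbor_separated_iff_ends[of xs n ys] perm(1) \<open>n \<ge> 3\<close>
    by (auto simp: neighbor_separated_families_def pairwise_def)
  show "pairwise (\<lambda>x y. ends_adjacent_in x y \<or> ends_adjacent_in y x) ?D"
    using sep by (auto simp: pairwise_def)
  have "finite F"
    using F finite_subset[of F "permutations_of_set {1..n}"]
    by (simp add: neighbor_separated_families_def)
  then show "finite ?D"
    by simp
  have eq: "ys = zs" if "ys \<in> F" "zs \<in> F" "{hd ys, last ys} = {hd zs, last zs}" for ys zs
    using sep[OF that(1,2)] that not_neighbors_in_ends[of ys] not_neighbors_in_ends[of zs]
      perm \<open>n \<ge> 3\<close> neighbors_in_sym
    unfolding ends_adjacent_in_def by (metis doubleton_eq_iff)
  show "card {ys \<in> ?D. ends_adjacent_in xs ys} \<le> 1" if xs: "xs \<in> ?D" for xs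
  proof -
    obtain w where w: "u = w" if "neighbors_in xs v u" for u
      using xs perm(2)[of xs] neighbors_in_hd[of xs] neighbors_in_last[of xs] by blast
    have ends: "{hd ys, last ys} = {v, w}" if "ys \<in> ?D" "ends_adjacent_in xs ys" for ys
      using that w neighbors_in_sym[of xs] unfolding ends_adjacent_in_def by blast
    have "ys = zs" if "ys \<in> {ys \<in> ?D. ends_adjacent_in xs ys}"
      "zs \<in> {ys \<in> ?D. ends_adjacent_in xs ys}" for ys zs
      using that ends[of ys] ends[of zs] eq[of ys zs] by auto
    then show ?thesis
      by (metis (no_types, lifting) One_nat_def card_le_Suc0_iff_eq card.infinite le0)
  qed
qed

text \<open>Double counting of the pairs of a member and one of its ends.\<close>

lemma card_neighbor_separated_family_le:
  assumes F: "F \<in> neighbor_separated_families n n" and "n \<ge> 3"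
  shows "2 * card F \<le> 3 * n"
proof -
  have fin: "finite F"
    using F finite_subset[of F "permutations_of_set {1..n}"]
    by (simp add: neighbor_separated_families_def)
  have two: "card {v \<in> {1..n}. v = hd xs \<or> v = last xs} = 2" if "xs \<in> F" for xs
  proof -
    have xs: "length xs = n" "distinct xs" "set xs = {1..n}"
      using F that permutation_of_interval[of xs n] by (auto simp: neighbor_separated_families_def)
    moreover have "xs \<noteq> []"
      using xs(1) \<open>n \<ge> 3\<close> by auto
    ultimately have "hd xs \<in> {1..n}" "last xs \<in> {1..n}" "hd xs \<noteq> last xs"
      using \<open>n \<ge> 3\<close>
      by (metis hd_in_set, metis last_in_set, auto simp: hd_conv_nth last_conv_nth nth_eq_iff_index_eq)
    then have "{v \<in> {1..n}. v = hd xs \<or> v = last xs} = {hd xs, last xs}"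
      by auto
    then show ?thesis
      using \<open>hd xs \<noteq> last xs\<close> by simp
  qed
  have "2 * card F = (\<Sum>xs\<in>F. card {v \<in> {1..n}. v = hd xs \<or> v = last xs})"
    using two by simp
  also have "\<dots> = (\<Sum>v\<in>{1..n}. card {xs \<in> F. v = hd xs \<or> v = last xs})"
    using sum.swap_restrict[OF fin, of "{1..n}" "\<lambda>_ _. 1::nat" "\<lambda>xs v. v = hd xs \<or> v = last xs"]
    by simp
  also have "\<dots> \<le> (\<Sum>v\<in>{1..n}. 3)"
    by (intro sum_mono card_family_with_end_le_3[OF assms])
  finally show ?thesis
    by simp
qed

lemma card_le_P: "F \<in> neighbor_separated_families n k \<Longrightarrow> card F \<le> P n k"
  unfolding P_def using finite_neighbor_separated_families by (intro Max_ge) auto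

lemma P_le:
  assumes "\<And>F. F \<in> neighbor_separated_families n k \<Longrightarrow> card F \<le> m"
  shows "P n k \<le> m"
  unfolding P_def using finite_neighbor_separated_families assms
  by (intro Max.boundedI) (auto intro: empty_in_neighbor_separated_families)

lemma P_1_1_le: "P 1 1 \<le> 1"
proof (rule P_le)
  fix F assume "F \<in> neighbor_separated_families 1 1"
  then have "card F \<le> card (permutations_of_set {1..1::nat})"
    by (intro card_mono) (auto simp: neighbor_separated_families_def)
  then show "card F \<le> 1" by simp
qed

section \<open>Families of spliced permutations\<close>

text \<open>
  A triple \<open>(c, l, r)\<close> stands for the permutation \<open>l @ r\<close> that may be cut between \<open>l\<close> and \<open>r\<close>; the
  color \<open>c\<close> is the class of its edge, the pair of its ends \<open>hd l\<close> and \<open>last r\<close>. The pair that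
  meets at the cut does not count as an adjacency, so that anything may be inserted there.
\<close>

definition runs_through :: "bool \<times> 'a list \<times> 'a list \<Rightarrow> bool \<times> 'a list \<times> 'a list \<Rightarrow> bool" where
  "runs_through = (\<lambda>(c, l, r) (d, l', r').
     neighbors_in l (hd l') (last r') \<or> neighbors_in r (hd l') (last r'))"

definition linked :: "bool \<times> 'a list \<times> 'a list \<Rightarrow> bool \<times> 'a list \<times> 'a list \<Rightarrow> bool" where
  "linked s t \<longleftrightarrow> runs_through s t \<or> runs_through t s"

definition splice_over :: "'a set \<Rightarrow> (bool \<Rightarrow> 'a list) \<Rightarrow> bool \<times> 'a list \<times> 'a list \<Rightarrow> bool" where
  "splice_over V p = (\<lambda>(c, l, r). l \<noteq> [] \<and> r \<noteq> [] \<and> l @ r \<in> permutations_of_set V \<and>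
     neighbors_in (p c) (hd l) (last r))"

text \<open>
  The sequence \<open>p c\<close> carries all edges of color \<open>c\<close>. It is what the members of another
  family insert at their cuts in order to contain these edges all at once.
\<close>

definition splice_family :: "'a set \<Rightarrow> (bool \<Rightarrow> 'a list) \<Rightarrow> (bool \<times> 'a list \<times> 'a list) set \<Rightarrow> bool" where
  "splice_family V p T \<longleftrightarrow> finite T \<and> (\<forall>c. p c \<in> permutations_of_set V) \<and>
     (\<forall>t\<in>T. splice_over V p t) \<and> pairwise linked T"

text \<open>
  A member of \<open>T\<close> of color \<open>c\<close> absorbs \<open>q c\<close>, and a member of \<open>S\<close> of color \<open>d\<close> absorbs \<open>p (\<not> d)\<close>. Hence if
  \<open>c = d\<close>, the path of the former contains the edge of the latter, and if \<open>c \<noteq> d\<close>, the path of the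
  latter contains the edge of the former. The inserted sequence joins the left part, which keeps the cut.
  The edges of one color in the union lie along \<open>p c @ q c\<close>.
\<close>

lemma splice_family_merge:
  assumes T: "splice_family V p T" and S: "splice_family W q S" and disj: "V \<inter> W = {}"
  shows "\<exists>p' T'. splice_family (V \<union> W) p' T' \<and> card T' = card T + card S"
proof -
  define f where "f = (\<lambda>(c, l, r). (c::bool, l @ q c, r :: 'a list))"
  define g where "g = (\<lambda>(c, l, r). (c::bool, l @ p (\<not> c), r :: 'a list))"
  define pq where "pq = (\<lambda>c. p c @ q c)"
  have fin: "finite T" "finite S"
    and p: "\<And>c. set (p c) = V" "\<And>c. distinct (p c)"
    and q: "\<And>c. set (q c) = W" "\<And>c. distinct (q c)"
    and linkT: "pairwise linked T" and linkS: "pairwise linked S"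
    using T S by (auto simp: splice_family_def permutations_of_set_def)
  have over: "\<And>t. t \<in> T \<Longrightarrow> splice_over V p t" "\<And>t. t \<in> S \<Longrightarrow> splice_over W q t"
    using T S by (auto simp: splice_family_def)
  have hdT: "hd (fst (snd t)) \<in> V" "fst (snd t) \<noteq> []" if "t \<in> T" for t
    using over(1)[OF that] by (auto simp: splice_over_def permutations_of_set_def)
  have hdS: "hd (fst (snd t)) \<in> W" "fst (snd t) \<noteq> []" if "t \<in> S" for t
    using over(2)[OF that] by (auto simp: splice_over_def permutations_of_set_def)
  have inj: "inj_on f T" "inj_on g S"
    by (auto simp: f_def g_def inj_on_def)
  have "f t \<noteq> g s" if "t \<in> T" "s \<in> S" for t s
  proof -
    have "hd (fst (snd (f t))) \<in> V" "hd (fst (snd (g s))) \<in> W"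
      using hdT[OF that(1)] hdS[OF that(2)] by (auto simp: f_def g_def split: prod.splits)
    with disj show ?thesis
      by auto
  qed
  then have "f ` T \<inter> g ` S = {}"
    by blast
  then have "card (f ` T \<union> g ` S) = card T + card S"
    using fin inj by (simp add: card_Un_disjoint card_image)
  moreover have "splice_family (V \<union> W) pq (f ` T \<union> g ` S)"
    unfolding splice_family_def
  proof (intro conjI allI ballI)
    show "finite (f ` T \<union> g ` S)"
      using fin by simp
    show "pq c \<in> permutations_of_set (V \<union> W)" for c
      using p q disj by (auto simp: pq_def permutations_of_set_def)
    show "splice_over (V \<union> W) pq u" if "u \<in> f ` T \<union> g ` S" for u
      using that
    proof
      assume "u \<in> f ` T"
      then obtain t where t: "t \<in> T" "u = f t" by blast
      then show ?thesis
        using over(1)[of t] q disj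
        by (auto simp: splice_over_def f_def pq_def permutations_of_set_def neighbors_in_append
            split: prod.splits)
    next
      assume "u \<in> g ` S"
      then obtain t where t: "t \<in> S" "u = g t" by blast
      then show ?thesis
        using over(2)[of t] p disj
        by (auto simp: splice_over_def g_def pq_def permutations_of_set_def neighbors_in_append
            split: prod.splits)
    qed
    have ff: "linked (f s) (f t)" if "linked s t" "s \<in> T" "t \<in> T" for s t
      using that(1) hdT[OF that(2)] hdT[OF that(3)]
      by (auto simp: linked_def runs_through_def f_def neighbors_in_append split: prod.splits)
    have gg: "linked (g s) (g t)" if "linked s t" "s \<in> S" "t \<in> S" for s t
      using that(1) hdS[OF that(2)] hdS[OF that(3)]
      by (auto simp: linked_def runs_through_def g_def neighbors_in_append split: prod.splits)
    have fg: "linked (f s) (g t)" if st: "s \<in> T" "t \<in> S" for s t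
    proof -
      obtain c l r d l' r' where eq: "s = (c, l, r)" "t = (d, l', r')"
        by (metis prod_cases3)
      have ne: "l \<noteq> []" "l' \<noteq> []"
        using hdT(2)[OF st(1)] hdS(2)[OF st(2)] eq by auto
      show ?thesis
      proof (cases "c = d")
        case True
        then have "neighbors_in (q c) (hd l') (last r')"
          using over(2)[OF st(2)] eq by (simp add: splice_over_def)
        then show ?thesis
          using ne by (simp add: linked_def runs_through_def f_def g_def eq neighbors_in_append)
      next
        case False
        then have "(\<not> d) = c" by auto
        moreover have "neighbors_in (p c) (hd l) (last r)"
          using over(1)[OF st(1)] eq by (simp add: splice_over_def)
        ultimately show ?thesis
          using ne by (simp add: linked_def runs_through_def f_def g_def eq neighbors_in_append)
      qed
    qed
    show "pairwise linked (f ` T \<union> g ` S)"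
    proof (rule pairwiseI)
      fix u u' assume u: "u \<in> f ` T \<union> g ` S" "u' \<in> f ` T \<union> g ` S" "u \<noteq> u'"
      have sym: "linked x y \<Longrightarrow> linked y x" for x y :: "bool \<times> 'a list \<times> 'a list"
        by (auto simp: linked_def)
      show "linked u u'"
        using u ff gg fg fg[THEN sym] linkT linkS unfolding pairwise_def image_iff Un_iff by metis
    qed
  qed
  ultimately show ?thesis by blast
qed

lemma splice_family_relabel:
  assumes T: "splice_family V p T" and "inj f"
  shows "\<exists>p' T'. splice_family (f ` V) p' T' \<and> card T' = card T"
proof (intro exI conjI)
  let ?g = "\<lambda>(c::bool, l, r). (c, map f l, map f r)"
  have "inj ?g"
    using \<open>inj f\<close> by (auto simp: inj_def)
  then show "card (?g ` T) = card T"
    by (meson card_image inj_on_subset subset_UNIV)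
  have perm: "map f xs \<in> permutations_of_set (f ` V)" if "xs \<in> permutations_of_set V" for xs
    using that \<open>inj f\<close> by (auto simp: permutations_of_set_def distinct_map inj_on_def inj_def)
  have over: "splice_over V p t" if "t \<in> T" for t
    using that T by (auto simp: splice_family_def)
  have over': "splice_over (f ` V) (\<lambda>c. map f (p c)) (?g t)" if "t \<in> T" for t
    using over[OF that] perm[of "fst (snd t) @ snd (snd t)"]
    by (auto simp: splice_over_def hd_map last_map neighbors_in_map split: prod.splits)
  have "runs_through (?g s) (?g t)" if "runs_through s t" "t \<in> T" for s t
    using that(1) over[OF that(2)]
    by (auto simp: runs_through_def splice_over_def hd_map last_map dest: neighbors_in_map
        split: prod.splits)
  then have linked: "linked (?g s) (?g t)" if "linked s t" "s \<in> T" "t \<in> T" for s t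
    using that unfolding linked_def by blast
  have link: "pairwise linked (?g ` T)"
  proof (rule pairwiseI)
    fix u u' assume "u \<in> ?g ` T" "u' \<in> ?g ` T" "u \<noteq> u'"
    then obtain s t where st: "s \<in> T" "t \<in> T" "s \<noteq> t" "u = ?g s" "u' = ?g t"
      by blast
    then have "linked s t"
      using T by (auto simp: splice_family_def dest: pairwiseD)
    then show "linked u u'"
      using linked st by blast
  qed
  show "splice_family (f ` V) (\<lambda>c. map f (p c)) (?g ` T)"
    unfolding splice_family_def
  proof (intro conjI allI ballI)
    show "finite (?g ` T)"
      using T by (simp add: splice_family_def)
    show "map f (p c) \<in> permutations_of_set (f ` V)" for c
      using T perm by (simp add: splice_family_def)
    show "splice_over (f ` V) (\<lambda>c. map f (p c)) u" if "u \<in> ?g ` T" for u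
      using that over' by blast
  qed (rule link)
qed

text \<open>
  The list \<open>w\<close> is empty for even \<open>n\<close>; it holds the one remaining element for odd \<open>n\<close>.
\<close>

lemma splice_family_neighbor_separated:
  assumes T: "splice_family V p T" and VW: "V \<union> set w = {1..n}" "V \<inter> set w = {}" "distinct w"
    and "n \<ge> 3"
  shows "card T \<le> P n n"
proof -
  define f where "f = (\<lambda>(c::bool, l, r). l @ w @ r :: nat list)"
  have over: "splice_over V p t" if "t \<in> T" for t
    using that T by (auto simp: splice_family_def)
  have perm: "f t \<in> permutations_of_set {1..n}" if "t \<in> T" for t
    using over[OF that] VW
    by (auto simp: splice_over_def f_def permutations_of_set_def split: prod.splits)
  have ends: "hd (f t) = hd (fst (snd t))" "last (f t) = last (snd (snd t))" if "t \<in> T" for t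
    using over[OF that] by (auto simp: splice_over_def f_def split: prod.splits)
  have "ends_adjacent_in (f s) (f t)" if "runs_through s t" "t \<in> T" for s t
    using that(1) unfolding ends_adjacent_in_def ends[OF that(2)]
    by (auto simp: runs_through_def f_def neighbors_in_append split: prod.splits)
  then have adj: "ends_adjacent_in (f s) (f t) \<or> ends_adjacent_in (f t) (f s)"
    if "s \<in> T" "t \<in> T" "s \<noteq> t" for s t
    using that T unfolding splice_family_def pairwise_def linked_def by blast
  have "inj_on f T"
  proof (rule inj_onI, rule ccontr)
    fix s t assume st: "s \<in> T" "t \<in> T" "f s = f t" "s \<noteq> t"
    then have "ends_adjacent_in (f s) (f s)"
      using adj by metis
    then show False
      using not_neighbors_in_ends[of "f s"] permutation_of_interval[OF perm[OF st(1)]] \<open>n \<ge> 3\<close>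
      by (simp add: ends_adjacent_in_def)
  qed
  then have "card T = card (f ` T)"
    by (simp add: card_image)
  also have "f ` T \<in> neighbor_separated_families n n"
    unfolding neighbor_separated_families_def
  proof (intro CollectI conjI pairwiseI)
    show "f ` T \<subseteq> permutations_of_set {1..n}"
      using perm by blast
    fix u u' assume "u \<in> f ` T" "u' \<in> f ` T" "u \<noteq> u'"
    then obtain s t where st: "s \<in> T" "t \<in> T" "s \<noteq> t" "u = f s" "u' = f t"
      by blast
    show "neighbor_separated n u u'"
      using neighbor_separated_iff_ends[of u n u'] permutation_of_interval(1)[OF perm] st adj \<open>n \<ge> 3\<close>
      by auto
  qed
  then have "card (f ` T) \<le> P n n"
    by (rule card_le_P)
  finally show ?thesis .
qed

section \<open>Explicit small families\<close>

lemma pairwise_set_if_sorted_wrt: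
  assumes "sorted_wrt R xs" "symp R"
  shows "pairwise R (set xs)"
  using assms(1) by (induction xs) (auto simp: pairwise_insert sympD[OF assms(2)])

lemma permutation_of_interval_iff:
  "xs \<in> permutations_of_set {1..n::nat} \<longleftrightarrow>
     distinct xs \<and> length xs = n \<and> list_all (\<lambda>x. 1 \<le> x \<and> x \<le> n) xs" (is "_ \<longleftrightarrow> ?R")
proof
  assume "xs \<in> permutations_of_set {1..n}"
  then show ?R
    using permutation_of_interval[of xs n] by (auto simp: list_all_iff)
next
  assume R: ?R
  then have "set xs \<subseteq> {1..n}" "card (set xs) = card {1..n}"
    by (auto simp: list_all_iff distinct_card)
  then have "set xs = {1..n}"
    by (intro card_subset_eq) auto
  with R show "xs \<in> permutations_of_set {1..n}"
    by (simp add: permutations_of_set_def)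
qed

lemma length_le_P:
  assumes "n \<ge> 2" "list_all (\<lambda>xs. xs \<in> permutations_of_set {1..n}) L" "distinct L"
    and "sorted_wrt (\<lambda>xs ys. ends_adjacent_in xs ys \<or> ends_adjacent_in ys xs) L"
  shows "length L \<le> P n n"
proof -
  have "pairwise (\<lambda>xs ys. ends_adjacent_in xs ys \<or> ends_adjacent_in ys xs) (set L)"
    using assms(4) by (rule pairwise_set_if_sorted_wrt) (auto intro: sympI)
  moreover have "set L \<subseteq> permutations_of_set {1..n}"
    using assms(2) by (auto simp: list_all_iff)
  moreover have "neighbor_separated n xs ys"
    if "ends_adjacent_in xs ys \<or> ends_adjacent_in ys xs" "xs \<in> set L" "ys \<in> set L" for xs ys
    using that assms(2) neighbor_separated_iff_ends[of xs n ys] permutation_of_interval(1) \<open>n \<ge> 2\<close>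
    by (auto simp: list_all_iff)
  ultimately have "set L \<in> neighbor_separated_families n n"
    unfolding neighbor_separated_families_def pairwise_def by blast
  then have "card (set L) \<le> P n n"
    by (rule card_le_P)
  then show ?thesis
    using \<open>distinct L\<close> by (simp add: distinct_card)
qed

text \<open>
  Cut paths are too weak for small even \<open>n\<close>: a cut path on \<open>n\<close> vertices keeps at most \<open>n - 2\<close>
  edges, and \<open>3 n / 2\<close> such paths can serve all pairs only if \<open>n - 2 \<ge> (3 n / 2 - 1) / 2\<close>, that
  is, \<open>n \<ge> 6\<close>. So \<open>n = 4\<close> needs a family of uncut paths, and \<open>n = 3\<close> and \<open>n = 5\<close> cannot be reached
  from \<open>n - 1\<close>. For \<open>n = 3\<close> and \<open>n = 4\<close> every pair of elements is the pair of ends of exactly one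
  member.
\<close>

lemma P_3_3_ge: "3 \<le> P 3 3"
proof -
  let ?L = "[[1, 3, 2], [2, 1, 3], [3, 2, 1]] :: nat list list"
  have "length ?L \<le> P 3 3"
    by (rule length_le_P)
      (unfold permutation_of_interval_iff ends_adjacent_in_def, simp_all)
  then show ?thesis
    by simp
qed

lemma P_4_4_ge: "6 \<le> P 4 4"
proof -
  let ?L = "[[1, 3, 4, 2], [1, 4, 2, 3], [1, 2, 3, 4],
    [2, 1, 4, 3], [2, 3, 1, 4], [3, 1, 2, 4]] :: nat list list"
  have "length ?L \<le> P 4 4"
    by (rule length_le_P)
      (unfold permutation_of_interval_iff ends_adjacent_in_def, simp_all)
  then show ?thesis
    by simp
qed

lemma P_5_5_ge: "6 \<le> P 5 5"
proof -
  let ?L = "[[1, 2, 3, 4, 5], [4, 5, 1, 2, 3], [2, 3, 5, 4, 1],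
    [1, 5, 2, 3, 4], [5, 3, 2, 1, 4], [3, 4, 5, 1, 2]] :: nat list list"
  have "length ?L \<le> P 5 5"
    by (rule length_le_P)
      (unfold permutation_of_interval_iff ends_adjacent_in_def, simp_all)
  then show ?thesis
    by simp
qed

lemma splice_family_of_list:
  assumes "\<And>c. p c \<in> permutations_of_set V" "list_all (splice_over V p) L"
    and "distinct L" "length L = m" "sorted_wrt linked L"
  shows "\<exists>p T. splice_family V p T \<and> card T = m"
proof (intro exI conjI)
  have "pairwise linked (set L)"
    using assms(5) by (rule pairwise_set_if_sorted_wrt) (auto simp: linked_def intro: sympI)
  then show "splice_family V p (set L)"
    using assms by (auto simp: splice_family_def list_all_iff)
  show "card (set L) = m"
    using assms(3,4) by (simp add: distinct_card)
qed

text \<open>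
  In the next three families the edges form the Moebius ladder on \<open>n = 2 m\<close> vertices: the cycle
  \<open>1, 2, \<dots>, n\<close> with the chords \<open>{i, i + m}\<close>. The cycle edges except \<open>{n, 1}\<close> lie along the path
  \<open>1, 2, \<dots>, n\<close>; this is the class \<open>True\<close>. The edge \<open>{n, 1}\<close> and the chords lie along the path
  \<open>m, n, 1, m + 1, 2, m + 2, 3, m + 3, \<dots>\<close>. The members come in the order of the edges: first
  the cycle, then the chords. Their paths were found by a computer search among the
  paths whose first and last steps are edges of the ladder; equality in the upper bound forces
  at every vertex that the three members ending there contain each other's edges cyclically.
\<close>

lemma moebius_ladder_splice_family_6:
  "\<exists>p T. splice_family {1..6::nat} p T \<and> card T = 9"
proof (rule splice_family_of_list)
  let ?p = "\<lambda>c. if c then [1, 2, 3, 4, 5, 6] else [3, 6, 1, 4, 2, 5] :: nat list"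
  let ?L = "[(True, [1, 4, 5], [6, 3, 2]),
     (True, [2, 5, 6, 1], [4, 3]),
     (True, [3, 6], [1, 2, 5, 4]),
     (True, [4, 1, 6], [3, 2, 5]),
     (True, [5, 4, 3], [2, 1, 6]),
     (False, [6, 3, 4], [5, 2, 1]),
     (False, [1, 6, 5], [2, 3, 4]),
     (False, [2, 1, 4], [3, 6, 5]),
     (False, [3, 2], [1, 4, 5, 6])]
     :: (bool \<times> nat list \<times> nat list) list"
  show "?p c \<in> permutations_of_set {1..6}" for c
    unfolding permutation_of_interval_iff by simp
  show "list_all (splice_over {1..6} ?p) ?L"
    unfolding splice_over_def permutation_of_interval_iff by simp
  show "distinct ?L" "length ?L = 9"
    by simp_all
  show "sorted_wrt linked ?L"
    unfolding linked_def runs_through_def by simp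
qed

lemma moebius_ladder_splice_family_8:
  "\<exists>p T. splice_family {1..8::nat} p T \<and> card T = 12"
proof (rule splice_family_of_list)
  let ?p = "\<lambda>c. if c then [1, 2, 3, 4, 5, 6, 7, 8] else [4, 8, 1, 5, 2, 6, 3, 7] :: nat list"
  let ?L = "[(True, [1, 5, 4, 8, 7, 3], [6, 2]),
     (True, [2, 1, 8, 4, 5, 6], [7, 3]),
     (True, [3, 2, 1, 8, 7], [6, 5, 4]),
     (True, [4, 8], [3, 7, 6, 2, 1, 5]),
     (True, [5, 4, 8, 7, 3], [1, 2, 6]),
     (True, [6, 5, 1, 2, 3, 4], [8, 7]),
     (True, [7, 3, 2, 6], [1, 5, 4, 8]),
     (False, [8, 7, 6, 5, 4, 3], [2, 1]),
     (False, [1, 8, 7], [4, 3, 2, 6, 5]),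
     (False, [2, 3, 4, 8, 1, 5], [7, 6]),
     (False, [3, 4, 8, 1, 5], [2, 6, 7]),
     (False, [4, 3, 7, 6, 2], [5, 1, 8])]
     :: (bool \<times> nat list \<times> nat list) list"
  show "?p c \<in> permutations_of_set {1..8}" for c
    unfolding permutation_of_interval_iff by simp
  show "list_all (splice_over {1..8} ?p) ?L"
    unfolding splice_over_def permutation_of_interval_iff by simp
  show "distinct ?L" "length ?L = 12"
    by simp_all
  show "sorted_wrt linked ?L"
    unfolding linked_def runs_through_def by simp
qed

lemma moebius_ladder_splice_family_10:
  "\<exists>p T. splice_family {1..10::nat} p T \<and> card T = 15"
proof (rule splice_family_of_list)
  let ?p = "\<lambda>c. if c then [1, 2, 3, 4, 5, 6, 7, 8, 9, 10] else [5, 10, 1, 6, 2, 7, 3, 8, 4, 9] :: nat list"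
  let ?L = "[(True, [1, 6, 7, 8, 9, 4, 5, 10], [3, 2]),
     (True, [2, 7, 8, 9], [6, 1, 10, 5, 4, 3]),
     (True, [3, 8, 7, 2, 1, 6, 5, 10], [9, 4]),
     (True, [4, 3, 8, 9, 10], [7, 2, 1, 6, 5]),
     (True, [5, 10, 9, 4], [1, 2, 3, 8, 7, 6]),
     (True, [6, 1, 10, 5, 4, 3, 2], [9, 8, 7]),
     (True, [7, 2], [6, 1, 10, 5, 4, 9, 3, 8]),
     (True, [8, 7, 2, 3, 4, 5, 6], [1, 10, 9]),
     (True, [9, 4, 3, 2, 1, 6, 7, 8], [5, 10]),
     (False, [10, 9], [6, 5, 4, 3, 8, 7, 2, 1]),
     (False, [1, 10], [3, 2, 7, 8, 9, 4, 5, 6]),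
     (False, [2, 1], [10, 9, 8, 3, 4, 5, 6, 7]),
     (False, [3, 2, 1, 6, 7], [4, 5, 10, 9, 8]),
     (False, [4, 5, 10, 1], [6, 7, 2, 3, 8, 9]),
     (False, [5, 4, 3, 8, 9], [2, 7, 6, 1, 10])]
     :: (bool \<times> nat list \<times> nat list) list"
  show "?p c \<in> permutations_of_set {1..10}" for c
    unfolding permutation_of_interval_iff by simp
  show "list_all (splice_over {1..10} ?p) ?L"
    unfolding splice_over_def permutation_of_interval_iff by simp
  show "distinct ?L" "length ?L = 15"
    by simp_all
  show "sorted_wrt linked ?L"
    unfolding linked_def runs_through_def by simp
qed

section \<open>The lower bound\<close>

text \<open>
  The step adds six elements, so the three residue classes of even numbers modulo six need the three starting
  values 6, 8 and 10.
\<close>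

lemma exists_splice_family:
  assumes "even n" "n \<ge> 6"
  shows "\<exists>p T. splice_family {1..n} p T \<and> 2 * card T = 3 * n"
  using assms
proof (induction n rule: less_induct)
  case (less n)
  have "n = 6 \<or> n = 8 \<or> n = 10 \<or> n \<ge> 12"
    using less.prems by presburger
  then consider "n = 6" | "n = 8" | "n = 10" | "n \<ge> 12"
    by blast
  then show ?case
  proof cases
    case 4
    then obtain p T where T: "splice_family {1..n - 6} p T" "2 * card T = 3 * (n - 6)"
      using less.IH[of "n - 6"] less.prems(1) by force
    obtain q S where S: "splice_family {1..6::nat} q S" "card S = 9"
      using moebius_ladder_splice_family_6 by blast
    define shift where "shift = (\<lambda>x. x + (n - 6))"
    have "inj shift"
      by (rule injI) (simp only: shift_def add_right_cancel)
    moreover have "shift ` {1..6} = {n - 5..n}"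
      unfolding shift_def image_add_atLeastAtMost' using 4 by simp
    ultimately obtain q' S' where S': "splice_family {n - 5..n} q' S'" "card S' = 9"
      using splice_family_relabel[OF S(1)] S(2) by metis
    have "{1..n - 6} \<union> {n - 5..n} = {1..n}" "{1..n - 6} \<inter> {n - 5..n} = {}"
      using 4 by auto
    then obtain p' T' where "splice_family {1..n} p' T'" "card T' = card T + card S'"
      using splice_family_merge[OF T(1) S'(1)] by auto
    then show ?thesis
      using T(2) S'(2) 4 by (intro exI[of _ p'] exI[of _ T']) auto
  qed (use moebius_ladder_splice_family_6 moebius_ladder_splice_family_8
      moebius_ladder_splice_family_10 in fastforce)+
qed

lemma P_even_ge:
  assumes "even n" "n \<ge> 4"
  shows "3 * n \<le> 2 * P n n"
proof (cases "n = 4")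
  case True
  then show ?thesis
    using P_4_4_ge by simp
next
  case False
  then have "n \<ge> 6"
    using assms by (auto elim!: evenE)
  then obtain p T where "splice_family {1..n} p T" "2 * card T = 3 * n"
    using exists_splice_family assms by blast
  then show ?thesis
    using splice_family_neighbor_separated[of "{1..n}" p T "[]" n] \<open>n \<ge> 6\<close> by simp
qed

lemma P_odd_ge:
  assumes "odd n"
  shows "3 * (n - 1) \<le> 2 * P n n"
proof -
  have "n = 1 \<or> n = 3 \<or> n = 5 \<or> n \<ge> 7"
    using assms by presburger
  then consider "n = 1" | "n = 3" | "n = 5" | "n \<ge> 7"
    by blast
  then show ?thesis
  proof cases
    case 4
    then have "even (n - 1)" "n - 1 \<ge> 6"
      using assms by simp_all
    then obtain p T where "splice_family {1..n - 1} p T" "2 * card T = 3 * (n - 1)"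
      using exists_splice_family by blast
    moreover have "{1..n - 1} \<union> {n} = {1..n}"
      using 4 by auto
    ultimately show ?thesis
      using splice_family_neighbor_separated[of "{1..n - 1}" p T "[n]" n] 4 by auto
  qed (use P_3_3_ge P_5_5_ge in simp_all)
qed

theorem theorem1p8:
  fixes n :: nat
  assumes "n \<ge> 1"
  shows "(even n \<and> n \<noteq> 2 \<longrightarrow> real (P n n) = 3 / 2 * real n) \<and>
         (odd n \<longrightarrow>
            \<lfloor>3 / 2 * real n\<rfloor> - 1 \<le> int (P n n) \<and> int (P n n) \<le> \<lfloor>3 / 2 * real n\<rfloor>)"
proof -
  have upper: "2 * P n n \<le> 3 * n" if "n \<noteq> 2"
  proof (cases "n = 1")
    case True
    then show ?thesis
      using P_1_1_le by simp
  next
    case False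
    have "P n n \<le> 3 * n div 2"
    proof (rule P_le)
      fix F assume "F \<in> neighbor_separated_families n n"
      then have "2 * card F \<le> 3 * n"
        using card_neighbor_separated_family_le False that assms by auto
      then show "card F \<le> 3 * n div 2"
        by simp
    qed
    then show ?thesis
      by simp
  qed
  have "real (P n n) = 3 / 2 * real n" if n: "even n" "n \<noteq> 2"
  proof -
    have "n \<ge> 4"
      using n assms by (auto elim!: evenE)
    then have "2 * P n n = 3 * n"
      using upper[OF n(2)] P_even_ge[OF n(1)] by simp
    then show ?thesis
      by linarith
  qed
  moreover have "\<lfloor>3 / 2 * real n\<rfloor> - 1 \<le> int (P n n) \<and> int (P n n) \<le> \<lfloor>3 / 2 * real n\<rfloor>"
    if n: "odd n"
  proof -
    from n obtain k where k: "n = 2 * k + 1"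
      by (elim oddE)
    have "\<lfloor>3 / 2 * real n\<rfloor> = 3 * int k + 1"
      using k by (intro floor_unique) auto
    moreover have "3 * k \<le> P n n" "P n n \<le> 3 * k + 1"
      using upper P_odd_ge[OF n] n k by auto
    ultimately show ?thesis
      by linarith
  qed
  ultimately show ?thesis
    by blast
qed

end
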